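(* Let $X$ be a Banach space and $E$ be a Banach lattice. If $E$ has weakly sequentially continuous lattice operations, then each almost L-weakly compact operator $T:X\rightarrow E$ is Dunford-Pettis.
   Context: All Banach spaces and Banach lattices are real, and operators are continuous linear maps. A Banach lattice $E$ has weakly sequentially continuous lattice operations if for every sequence $(x_n)$ in $E$, $x_n\to 0$ weakly implies $|x_n|\to 0$ weakly. A nonempty norm bounded subset $A$ of a Banach lattice $E$ is L-weakly compact if $\|y_n\|\to 0$ for every disjoint sequence $(y_n)$ contained in the solid hull $\{y\in E: |y|\le |a| \text{ for some } a\in A\}$ of $A$. An operator $T$ from a Banach space $X$ into a Banach lattice $E$ is almost L-weakly compact if $T$ maps relatively weakly compact subsets of $X$ onto L-weakly compact subsets of $E$. An operator $T$ between Banach spaces is Dunford-Pettis if $\|T(x_n)\|\to 0$ for every weakly null sequence $(x_n)$ in its domain. *)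

theory Defs
  imports "HOL-Analysis.Analysis" "HOL-Library.Lattice_Algebras"
begin

section \<open>Banach lattices\<close>

text \<open>
  The class \<open>lattice_ab_group_add_abs\<close> supplies the modulus \<open>\<bar>x\<bar> = sup x (- x)\<close>.
\<close>

class banach_lattice = banach + ordered_real_vector + lattice_ab_group_add_abs +
  assumes norm_lattice_mono: "\<bar>x\<bar> \<le> \<bar>y\<bar> \<Longrightarrow> norm x \<le> norm y"

instance real :: banach_lattice
  by standard simp

section \<open>The weak topology\<close>

definition weak_topology :: "'a::real_normed_vector topology" where
  "weak_topology =
     topology_generated_by {f -` U | (f :: 'a \<Rightarrow> real) U. bounded_linear f \<and> open U}"

definition weakly_null :: "(nat \<Rightarrow> 'a::real_normed_vector) \<Rightarrow> bool" where
  "weakly_null x \<longleftrightarrow> limitin weak_topology x 0 sequentially"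

definition relatively_weakly_compact :: "'a::real_normed_vector set \<Rightarrow> bool" where
  "relatively_weakly_compact A \<longleftrightarrow> compactin weak_topology (weak_topology closure_of A)"

lemma topspace_weak_topology [simp]: "topspace weak_topology = UNIV"
  unfolding weak_topology_def topology_generated_by_topspace
  using bounded_linear_zero by blast

lemma continuous_map_weak_topology:
  fixes f :: "'a::real_normed_vector \<Rightarrow> real"
  assumes "bounded_linear f"
  shows "continuous_map weak_topology euclidean f"
  unfolding continuous_map_alt weak_topology_def
proof (intro conjI allI impI)
  fix U :: "real set"
  assume "openin euclidean U"
  then have "f -` U \<in> {f -` U | (f :: 'a \<Rightarrow> real) U. bounded_linear f \<and> open U}"
    using assms by auto
  then show "openin (topology_generated_by {f -` U | (f :: 'a \<Rightarrow> real) U. bounded_linear f \<and> open U})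
      (f -` U \<inter> topspace (topology_generated_by {f -` U | (f :: 'a \<Rightarrow> real) U. bounded_linear f \<and> open U}))"
    unfolding weak_topology_def[symmetric] topspace_weak_topology Int_UNIV_right
    unfolding weak_topology_def
    by (rule topology_generated_by_Basis)
qed auto

lemma weakly_null_iff:
  fixes x :: "nat \<Rightarrow> 'a::real_normed_vector"
  shows "weakly_null x \<longleftrightarrow> (\<forall>f :: 'a \<Rightarrow> real. bounded_linear f \<longrightarrow> (\<lambda>n. f (x n)) \<longlonglongrightarrow> 0)"
proof (intro iffI allI impI)
  fix f :: "'a \<Rightarrow> real"
  assume "weakly_null x" and f: "bounded_linear f"
  then have "limitin euclidean (f \<circ> x) (f 0) sequentially"
    unfolding weakly_null_def
    by (intro continuous_map_limit[OF continuous_map_weak_topology[OF f]])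
  moreover have "f 0 = 0"
    using f by (simp add: linear_simps)
  ultimately show "(\<lambda>n. f (x n)) \<longlonglongrightarrow> 0"
    by (simp add: o_def)
next
  assume *: "\<forall>f :: 'a \<Rightarrow> real. bounded_linear f \<longrightarrow> (\<lambda>n. f (x n)) \<longlonglongrightarrow> 0"
  have "0 \<in> W \<longrightarrow> eventually (\<lambda>n. x n \<in> W) sequentially"
    if "generate_topology_on {f -` U | (f :: 'a \<Rightarrow> real) U. bounded_linear f \<and> open U} W" for W
    using that
  proof induction
    case Empty
    then show ?case by simp
  next
    case (Int V W)
    then show ?case by (auto intro: eventually_conj)
  next
    case (UN K)
    show ?case
    proof
      assume "0 \<in> \<Union>K"
      then obtain V where V: "V \<in> K" "0 \<in> V" by blast
      with UN.IH have "eventually (\<lambda>n. x n \<in> V) sequentially" by blast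
      then show "eventually (\<lambda>n. x n \<in> \<Union>K) sequentially"
        by (rule eventually_mono) (use V in blast)
    qed
  next
    case (Basis s)
    then obtain f :: "'a \<Rightarrow> real" and U where s: "s = f -` U" "bounded_linear f" "open U"
      by blast
    then have "f 0 = 0" by (simp add: linear_simps)
    moreover have "(\<lambda>n. f (x n)) \<longlonglongrightarrow> 0" using * s by blast
    ultimately show ?case
      using s by (auto dest: topological_tendstoD)
  qed
  then show "weakly_null x"
    unfolding weakly_null_def limitin_def topspace_weak_topology
    by (auto simp: weak_topology_def openin_topology_generated_by_iff)
qed

section \<open>Properties of Banach lattices and of their subsets\<close>

definition weakly_seq_continuous_lattice_operations :: "'a::banach_lattice itself \<Rightarrow> bool" where
  "weakly_seq_continuous_lattice_operations _ \<longleftrightarrow>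
     (\<forall>x :: nat \<Rightarrow> 'a. weakly_null x \<longrightarrow> weakly_null (\<lambda>n. \<bar>x n\<bar>))"

definition solid_hull :: "'a::banach_lattice set \<Rightarrow> 'a set" where
  "solid_hull A = {y. \<exists>a\<in>A. \<bar>y\<bar> \<le> \<bar>a\<bar>}"

definition disjoint_sequence :: "(nat \<Rightarrow> 'a::banach_lattice) \<Rightarrow> bool" where
  "disjoint_sequence y \<longleftrightarrow> (\<forall>m n. m \<noteq> n \<longrightarrow> inf \<bar>y m\<bar> \<bar>y n\<bar> = 0)"

definition L_weakly_compact :: "'a::banach_lattice set \<Rightarrow> bool" where
  "L_weakly_compact A \<longleftrightarrow> A \<noteq> {} \<and> bounded A \<and>
     (\<forall>y. disjoint_sequence y \<and> range y \<subseteq> solid_hull A \<longrightarrow> (\<lambda>n. norm (y n)) \<longlonglongrightarrow> 0)"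

section \<open>Classes of operators\<close>

text \<open>
  The two predicates below are meant for bounded linear \<open>T\<close>.  Since L-weakly compact sets are
  nonempty, only nonempty relatively weakly compact sets are tested; without this restriction the
  empty set would prevent every operator from being almost L-weakly compact.
\<close>

definition almost_L_weakly_compact :: "('a::banach \<Rightarrow> 'b::banach_lattice) \<Rightarrow> bool" where
  "almost_L_weakly_compact T \<longleftrightarrow>
     (\<forall>A. A \<noteq> {} \<and> relatively_weakly_compact A \<longrightarrow> L_weakly_compact (T ` A))"

definition Dunford_Pettis :: "('a::banach \<Rightarrow> 'b::banach) \<Rightarrow> bool" where
  "Dunford_Pettis T \<longleftrightarrow> (\<forall>x. weakly_null x \<longrightarrow> (\<lambda>n. norm (T (x n))) \<longlonglongrightarrow> 0)"

end

theory Submission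
  imports Defs
begin

text \<open>
  Let \<open>x\<close> be weakly null.  The set \<open>{0} \<union> range x\<close> is relatively weakly compact, so its image
  under \<open>T\<close> is L-weakly compact, and the hypothesis on \<open>'e\<close> makes \<open>a n = \<bar>T (x n)\<bar>\<close> weakly null.
  Everything therefore rests on one fact about Banach lattices,
  \<open>positive_weakly_null_norm_null\<close>: a positive weakly null sequence \<open>a\<close> with L-weakly compact
  range tends to \<open>0\<close> in norm.

  First, \<open>a\<close> is almost order bounded (\<open>L_weakly_compact_almost_order_bounded\<close>): up to a part of
  small norm, all \<open>a n\<close> lie below a single \<open>u\<close>, a multiple of a finite sum of terms of \<open>a\<close>.
  Otherwise, in a suitable subsequence, each term would exceed a large multiple of the sum of the
  earlier ones by a residual of large norm, and these residuals can be trimmed to a disjoint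
  sequence at little cost in norm.
  The interval \<open>{0..u}\<close> inherits L-weak compactness from the range of \<open>a\<close>, so it remains to
  treat \<open>b n = inf (a n) u\<close>.

  In an L-weakly compact order interval, monotone sequences converge in norm
  (\<open>increasing_order_bounded_convergent\<close>): the way in which an increasing sequence crosses a fixed
  level \<open>t\<close> between 0 and \<open>u\<close>, namely \<open>inf (pprt (s (Suc n) - t)) (pprt (t - s n))\<close>, is a
  disjoint sequence, and an increment of \<open>s\<close> is controlled by its crossings of finitely many
  levels.

  Now suppose \<open>norm (b n) \<ge> \<epsilon>\<close> infinitely often.  Take positive functionals \<open>f n\<close> of norm at most 1
  with \<open>f n (b n) = norm (b n)\<close>, and one positive functional \<open>g\<close> dominating a multiple
  of each of them.  As \<open>g (b n)\<close> tends to \<open>0\<close>, there are terms \<open>c k\<close> of norm at least \<open>\<epsilon>\<close> with \<open>g (c k) \<le> (1/2) ^ k\<close>.  The suprema of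
  the tails of \<open>c\<close> exist as norm limits and decrease to some \<open>h\<close> with \<open>g h = 0\<close>, hence every
  \<open>f n\<close> vanishes at \<open>h\<close>.  This is impossible, because the functional norming \<open>c k\<close> is at least
  \<open>\<epsilon>\<close> at the \<open>k\<close>-th tail supremum, and these suprema converge to \<open>h\<close> in norm
  (\<open>order_bounded_weakly_null_norm_null\<close>).
\<close>

section \<open>Relative weak compactness of weakly null sequences\<close>

text \<open>
  A finite subfamily of a cover of the closure already covers \<open>K\<close>; regularity separates the compact
  set \<open>K\<close> from the closed complement of that subfamily, so the closure of \<open>K\<close> avoids the complement.
\<close>

lemma compactin_closure_of_regular_space:
  assumes reg: "regular_space X" and K: "compactin X K"
  shows "compactin X (X closure_of K)"
  unfolding compactin_def
proof (intro conjI allI impI)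
  show "X closure_of K \<subseteq> topspace X"
    by (rule closure_of_subset_topspace)
next
  fix \<U> assume \<U>: "Ball \<U> (openin X) \<and> X closure_of K \<subseteq> \<Union>\<U>"
  have "K \<subseteq> X closure_of K"
    using K by (simp add: closure_of_subset compactin_subset_topspace)
  then have "K \<subseteq> \<Union>\<U>"
    using \<U> by blast
  then obtain \<F> where \<F>: "finite \<F>" "\<F> \<subseteq> \<U>" "K \<subseteq> \<Union>\<F>"
    using compactinD[OF K, of \<U>] \<U> by auto
  have "openin X (\<Union>\<F>)"
    using \<F> \<U> by (auto intro: openin_Union)
  then have closed: "closedin X (topspace X - \<Union>\<F>)"
    by (rule openin_closedin_eq[THEN iffD1, THEN conjunct2])
  have disj: "disjnt K (topspace X - \<Union>\<F>)"
    using \<F>(3) unfolding disjnt_def by blast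
  obtain U V where UV: "openin X U" "openin X V" "K \<subseteq> U" "topspace X - \<Union>\<F> \<subseteq> V" "disjnt U V"
    using regular_space_compact_closed_separation[OF reg K closed disj] by metis
  have "V \<inter> X closure_of K = {}"
    using openin_Int_closure_of_eq_empty[OF UV(2), of K] UV(3,5) by (auto simp: disjnt_iff)
  then have "X closure_of K \<subseteq> \<Union>\<F>"
    using UV(4) closure_of_subset_topspace[of X K] by blast
  with \<F> show "\<exists>\<F>. finite \<F> \<and> \<F> \<subseteq> \<U> \<and> X closure_of K \<subseteq> \<Union>\<F>"
    by blast
qed

text \<open>
  Subbasic neighbourhoods contain preimages of closed balls, and this property passes to finite
  intersections and unions.
\<close>

lemma regular_space_weak_topology: "regular_space (weak_topology :: 'a::real_normed_vector topology)"
proof -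
  have *: "\<exists>V C. openin weak_topology V \<and> closedin weak_topology C \<and> z \<in> V \<and> V \<subseteq> C \<and> C \<subseteq> W"
    if "generate_topology_on {f -` U | (f :: 'a \<Rightarrow> real) U. bounded_linear f \<and> open U} W" "z \<in> W" for W z
    using that
  proof induction
    case Empty
    then show ?case by simp
  next
    case (Int W1 W2)
    then obtain V1 C1 V2 C2 where
      "openin weak_topology V1 \<and> closedin weak_topology C1 \<and> z \<in> V1 \<and> V1 \<subseteq> C1 \<and> C1 \<subseteq> W1"
      "openin weak_topology V2 \<and> closedin weak_topology C2 \<and> z \<in> V2 \<and> V2 \<subseteq> C2 \<and> C2 \<subseteq> W2"
      by blast
    then have "openin weak_topology (V1 \<inter> V2) \<and> closedin weak_topology (C1 \<inter> C2) \<and>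
        z \<in> V1 \<inter> V2 \<and> V1 \<inter> V2 \<subseteq> C1 \<inter> C2 \<and> C1 \<inter> C2 \<subseteq> W1 \<inter> W2"
      by (auto intro: openin_Int closedin_Int)
    then show ?case by (intro exI)
  next
    case (UN K)
    then obtain W where "W \<in> K" "z \<in> W" by blast
    with UN.IH[of W] obtain V C where
      "openin weak_topology V \<and> closedin weak_topology C \<and> z \<in> V \<and> V \<subseteq> C \<and> C \<subseteq> W"
      by blast
    with \<open>W \<in> K\<close> have "openin weak_topology V \<and> closedin weak_topology C \<and> z \<in> V \<and> V \<subseteq> C \<and> C \<subseteq> \<Union>K"
      by blast
    then show ?case by (intro exI)
  next
    case (Basis s)
    then obtain f :: "'a \<Rightarrow> real" and U where s: "s = f -` U" "bounded_linear f" "open U"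
      by blast
    then obtain e where e: "e > 0" "cball (f z) e \<subseteq> U"
      using Basis.prems by (metis open_contains_cball vimageE)
    have "openin weak_topology {x \<in> topspace weak_topology. f x \<in> ball (f z) e}"
      by (rule openin_continuous_map_preimage[OF continuous_map_weak_topology[OF s(2)]]) simp
    moreover have "closedin weak_topology {x \<in> topspace weak_topology. f x \<in> cball (f z) e}"
      by (rule closedin_continuous_map_preimage[OF continuous_map_weak_topology[OF s(2)]]) simp
    ultimately have "openin weak_topology (f -` ball (f z) e)" "closedin weak_topology (f -` cball (f z) e)"
      by (simp_all add: vimage_def)
    moreover have "z \<in> f -` ball (f z) e" "f -` ball (f z) e \<subseteq> f -` cball (f z) e" "f -` cball (f z) e \<subseteq> s"
      using e by (auto simp: s(1))
    ultimately show ?case by (intro exI conjI)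
  qed
  have "\<exists>V C. openin weak_topology V \<and> closedin weak_topology C \<and> z \<in> V \<and> V \<subseteq> C \<and> C \<subseteq> W"
    if "openin weak_topology W" "z \<in> W" for W and z :: 'a
  proof (rule *[OF _ that(2)])
    show "generate_topology_on {f -` U | (f :: 'a \<Rightarrow> real) U. bounded_linear f \<and> open U} W"
      using that(1) unfolding weak_topology_def openin_topology_generated_by_iff .
  qed
  then show ?thesis
    unfolding neighbourhood_base_of_closedin[symmetric] neighbourhood_base_of by blast
qed

lemma relatively_weakly_compact_weakly_null:
  assumes "weakly_null x"
  shows "relatively_weakly_compact (insert 0 (range x))"
proof -
  have "compactin weak_topology (insert 0 (range x))"
    using assms unfolding weakly_null_def
    by (rule compactin_sequence_with_limit) simp_all
  then show ?thesis
    unfolding relatively_weakly_compact_def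
    by (rule compactin_closure_of_regular_space[OF regular_space_weak_topology])
qed

section \<open>Linear functionals below a sublinear one\<close>

text \<open>
  Only one inequality of positive homogeneity is required, which makes sublinearity easy to verify;
  the other one follows.
\<close>

definition sublinear :: "('a::real_vector \<Rightarrow> real) \<Rightarrow> bool" where
  "sublinear p \<longleftrightarrow> (\<forall>x y. p (x + y) \<le> p x + p y) \<and> (\<forall>c x. 0 \<le> c \<longrightarrow> p (c *\<^sub>R x) \<le> c * p x)"

lemma sublinearD:
  assumes "sublinear p"
  shows "p (x + y) \<le> p x + p y" "p 0 = 0" "0 \<le> c \<Longrightarrow> p (c *\<^sub>R x) = c * p x" "- p (- x) \<le> p x"
proof -
  show add: "p (x + y) \<le> p x + p y" for x y
    using assms by (simp add: sublinear_def)
  have hom: "p (c *\<^sub>R x) \<le> c * p x" if "0 \<le> c" for c x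
    using assms that by (simp add: sublinear_def)
  show zero: "p 0 = 0"
    using add[of 0 0] hom[of 0 0] by simp
  show "p (c *\<^sub>R x) = c * p x" if "0 \<le> c"
  proof (cases "c = 0")
    case False
    with that have "c > 0" by simp
    then have "p x \<le> inverse c * p (c *\<^sub>R x)"
      using hom[of "inverse c" "c *\<^sub>R x"] by simp
    with \<open>c > 0\<close> hom[of c x] show ?thesis
      by (simp add: field_simps)
  qed (simp add: zero)
  show "- p (- x) \<le> p x"
    using add[of x "- x"] zero by simp
qed

text \<open>
  The functional is the infimum over \<open>t \<ge> 0\<close> of \<open>p (x + t y) - t p y\<close>, the largest sublinear
  functional below \<open>p\<close> whose value at \<open>- y\<close> is at most \<open>- p y\<close>.  A minimal \<open>p\<close>
  coincides with all these functionals, and is therefore odd.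
\<close>

lemma sublinear_tangent:
  assumes p: "sublinear p"
  obtains q where "sublinear q" "q \<le> p" "q (- y) \<le> - p y"
proof -
  define I where "I x = (\<lambda>t. p (x + t *\<^sub>R y) - t * p y) ` {0..}" for x
  define q where "q x = Inf (I x)" for x
  have bdd: "bdd_below (I x)" for x
  proof (rule bdd_belowI)
    fix r assume "r \<in> I x"
    then obtain t where t: "t \<ge> 0" "r = p (x + t *\<^sub>R y) - t * p y"
      by (auto simp: I_def)
    have "t * p y \<le> p (x + t *\<^sub>R y) + p (- x)"
      using sublinearD(1)[OF p, of "x + t *\<^sub>R y" "- x"] sublinearD(3)[OF p t(1), of y] by simp
    then show "- p (- x) \<le> r" by (simp add: t(2))
  qed
  have le: "q x \<le> p (x + t *\<^sub>R y) - t * p y" if "t \<ge> 0" for x t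
    unfolding q_def using that by (intro cInf_lower bdd) (auto simp: I_def)
  have ge: "r \<le> q x" if "\<And>t. t \<ge> 0 \<Longrightarrow> r \<le> p (x + t *\<^sub>R y) - t * p y" for r x
    unfolding q_def using that by (intro cInf_greatest) (auto simp: I_def)
  have "sublinear q"
    unfolding sublinear_def
  proof (intro conjI allI impI)
    fix u v
    have "q (u + v) - q u \<le> q v"
    proof (rule ge)
      fix t :: real assume t: "t \<ge> 0"
      have "q (u + v) - (p (v + t *\<^sub>R y) - t * p y) \<le> q u"
      proof (rule ge)
        fix s :: real assume s: "s \<ge> 0"
        have "q (u + v) \<le> p ((u + s *\<^sub>R y) + (v + t *\<^sub>R y)) - (s + t) * p y"
          using le[of "s + t" "u + v"] s t by (simp add: algebra_simps)
        also have "\<dots> \<le> p (u + s *\<^sub>R y) + p (v + t *\<^sub>R y) - (s + t) * p y"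
          by (simp add: sublinearD(1)[OF p])
        finally show "q (u + v) - (p (v + t *\<^sub>R y) - t * p y) \<le> p (u + s *\<^sub>R y) - s * p y"
          by (simp add: algebra_simps)
      qed
      then show "q (u + v) - q u \<le> p (v + t *\<^sub>R y) - t * p y" by simp
    qed
    then show "q (u + v) \<le> q u + q v" by simp
  next
    fix c :: real and u assume c: "0 \<le> c"
    show "q (c *\<^sub>R u) \<le> c * q u"
    proof (cases "c = 0")
      case True
      then show ?thesis using le[of 0 0] by (simp add: sublinearD[OF p])
    next
      case False
      with c have c: "c > 0" by simp
      have "q (c *\<^sub>R u) / c \<le> q u"
      proof (rule ge)
        fix t :: real assume t: "t \<ge> 0"
        have "q (c *\<^sub>R u) \<le> p (c *\<^sub>R (u + t *\<^sub>R y)) - c * t * p y"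
          using le[of "c * t" "c *\<^sub>R u"] c t by (simp add: algebra_simps)
        also have "\<dots> = (p (u + t *\<^sub>R y) - t * p y) * c"
          using c by (subst sublinearD(3)[OF p]) (simp_all add: algebra_simps)
        finally show "q (c *\<^sub>R u) / c \<le> p (u + t *\<^sub>R y) - t * p y"
          using c by (simp add: divide_le_eq)
      qed
      then show ?thesis using c by (simp add: divide_le_eq mult.commute)
    qed
  qed
  moreover have "q \<le> p"
    using le[of 0] by (simp add: le_fun_def)
  moreover have "q (- y) \<le> - p y"
    using le[of 1 "- y"] by (simp add: sublinearD(2)[OF p])
  ultimately show thesis by (rule that)
qed

text \<open>
  Zorn's lemma applies because \<open>- p (- x) \<le> q x\<close> for every sublinear \<open>q \<le> p\<close>, so that a chain has
  a finite pointwise infimum, which is again sublinear.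
\<close>

lemma minimal_sublinear_exists:
  assumes p: "sublinear p"
  obtains f where "sublinear f" "f \<le> p" "\<And>q. sublinear q \<Longrightarrow> q \<le> f \<Longrightarrow> q = f"
proof -
  define A where "A = {q. sublinear q \<and> q \<le> p}"
  have lower: "- p (- x) \<le> q x" if "q \<in> A" for q x
    using that sublinearD(4)[of q x] by (auto simp: A_def le_fun_def intro: order_trans[rotated])
  have "\<exists>f\<in>A. \<forall>q\<in>A. q \<le> f \<longrightarrow> q = f"
  proof (rule predicate_Zorn)
    show "partial_order_on A (relation_of (\<lambda>f q. q \<le> f) A)"
      by (rule partial_order_on_relation_ofI) auto
  next
    fix C assume C: "C \<in> Chains (relation_of (\<lambda>f q. q \<le> f) A)"
    then have CA: "C \<subseteq> A" and chain: "\<And>q r. q \<in> C \<Longrightarrow> r \<in> C \<Longrightarrow> q \<le> r \<or> r \<le> q"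
      unfolding Chains_def relation_of_def by auto
    show "\<exists>u\<in>A. \<forall>q\<in>C. u \<le> q"
    proof (cases "C = {}")
      case True
      then show ?thesis using p by (auto simp: A_def)
    next
      case False
      define u where "u x = (INF q\<in>C. q x)" for x
      have le: "u x \<le> q x" if "q \<in> C" for q x
        unfolding u_def using that lower CA by (intro cINF_lower bdd_belowI2) auto
      have ge: "r \<le> u x" if "\<And>q. q \<in> C \<Longrightarrow> r \<le> q x" for r x
        unfolding u_def using that False by (intro cINF_greatest) auto
      have sub: "sublinear q" if "q \<in> C" for q
        using that CA by (auto simp: A_def)
      have "sublinear u"
        unfolding sublinear_def
      proof (intro conjI allI impI)
        fix x y
        have "u (x + y) - u x \<le> u y"
        proof (rule ge)
          fix q assume q: "q \<in> C"
          have "u (x + y) - q y \<le> u x"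
          proof (rule ge)
            fix r assume r: "r \<in> C"
            obtain m where m: "m \<in> C" "m \<le> q" "m \<le> r"
              using chain[OF q r] q r by blast
            have "u (x + y) \<le> m x + m y"
              using le[OF m(1), of "x + y"] sublinearD(1)[OF sub[OF m(1)], of x y] by simp
            also have "\<dots> \<le> r x + q y"
              using m by (auto simp: le_fun_def intro: add_mono)
            finally show "u (x + y) - q y \<le> r x" by simp
          qed
          then show "u (x + y) - u x \<le> q y" by simp
        qed
        then show "u (x + y) \<le> u x + u y" by simp
      next
        fix c :: real and x assume c: "0 \<le> c"
        show "u (c *\<^sub>R x) \<le> c * u x"
        proof (cases "c = 0")
          case True
          then show ?thesis using False le[of _ 0] sublinearD(2)[OF sub] by fastforce
        next
          case False
          with c have c: "c > 0" by simp
          have "u (c *\<^sub>R x) / c \<le> u x"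
            using c le[of _ "c *\<^sub>R x"] sublinearD(3)[OF sub]
            by (intro ge) (auto simp: divide_le_eq mult.commute)
          then show ?thesis using c by (simp add: divide_le_eq mult.commute)
        qed
      qed
      moreover obtain q where "q \<in> C" using False by blast
      then have "u \<le> p"
        using le[of q] CA by (force simp: A_def le_fun_def intro: order_trans)
      ultimately show ?thesis using le by (auto simp: A_def le_fun_def)
    qed
  qed
  then obtain f where "f \<in> A" "\<And>q. q \<in> A \<Longrightarrow> q \<le> f \<Longrightarrow> q = f" by blast
  then show thesis
    by (intro that[of f]) (auto simp: A_def)
qed

text \<open>
  A minimal sublinear functional is odd, and an odd sublinear functional is linear.  Starting
  the descent from the tangent of \<open>p\<close> at \<open>b\<close> forces the value at \<open>b\<close>.
\<close>

theorem Hahn_Banach_support: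
  assumes p: "sublinear p"
  obtains f where "linear f" "f \<le> p" "f b = p b"
proof -
  obtain q where q: "sublinear q" "q \<le> p" "q (- b) \<le> - p b"
    using sublinear_tangent[OF p] .
  obtain f where f: "sublinear f" "f \<le> q" and min: "\<And>r. sublinear r \<Longrightarrow> r \<le> f \<Longrightarrow> r = f"
    using minimal_sublinear_exists[OF q(1)] by metis
  have neg: "f (- y) = - f y" for y
  proof -
    obtain r where r: "sublinear r" "r \<le> f" "r (- y) \<le> - f y"
      using sublinear_tangent[OF f(1)] .
    with min[OF r(1,2)] sublinearD(4)[OF f(1), of "- y"] show ?thesis by simp
  qed
  have add: "f (x + y) = f x + f y" for x y
    using sublinearD(1)[OF f(1), of x y] sublinearD(1)[OF f(1), of "- x" "- y"] neg[of "x + y"]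
    by (simp add: neg)
  have "f (c *\<^sub>R x) = c * f x" for c x
  proof (cases "c \<ge> 0")
    case False
    then show ?thesis
      using sublinearD(3)[OF f(1), of "- c" x] neg[of "c *\<^sub>R x"] by simp
  qed (simp add: sublinearD(3)[OF f(1)])
  then have "linear f"
    by (intro linearI add) simp
  moreover have "f \<le> p" using f(2) q(2) by (rule order_trans)
  moreover have "f b = p b"
  proof (rule antisym)
    show "f b \<le> p b" using \<open>f \<le> p\<close> by (simp add: le_fun_def)
    have "f (- b) \<le> - p b" using f(2) q(3) by (metis le_fun_def order_trans)
    then show "p b \<le> f b" by (simp add: neg)
  qed
  ultimately show thesis by (rule that)
qed

section \<open>Lattice-ordered groups and Banach lattices\<close>

text \<open>
  Translation invariance gives \<open>inf x s + w - s \<le> inf x w\<close> for \<open>w \<le> s\<close>; taking \<open>w = y\<close> and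
  \<open>w = z\<close> with \<open>s = sup y z\<close> yields the nontrivial inequality.
\<close>

lemma inf_sup_distrib_lattice_group:
  fixes x y z :: "'a::lattice_ab_group_add"
  shows "inf x (sup y z) = sup (inf x y) (inf x z)"
proof (rule antisym)
  define s where "s = sup y z"
  define k where "k = inf x s"
  define t where "t = sup (inf x y) (inf x z)"
  have *: "k + w - s \<le> inf x w" if "w \<le> s" for w
  proof (rule inf_greatest)
    have "k \<le> x" "k \<le> s" by (simp_all add: k_def)
    have "k + w \<le> x + s" using \<open>k \<le> x\<close> that by (rule add_mono)
    moreover have "k + w \<le> w + s" using \<open>k \<le> s\<close> by (simp add: add.commute)
    ultimately show "k + w - s \<le> x" "k + w - s \<le> w"
      by (simp_all add: diff_le_eq)
  qed
  have "k + y - s \<le> t" "k + z - s \<le> t"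
    using *[of y] *[of z] unfolding t_def s_def by (simp_all add: le_supI1 le_supI2)
  then have "y \<le> t + s - k" "z \<le> t + s - k"
    by (simp_all add: algebra_simps)
  then have "s \<le> t + s - k"
    unfolding s_def by (rule sup_least)
  then show "inf x (sup y z) \<le> sup (inf x y) (inf x z)"
    unfolding s_def[symmetric] k_def[symmetric] t_def[symmetric] by (simp add: algebra_simps)
qed (auto intro: le_infI1 le_infI2 le_supI1 le_supI2)

lemma inf_add_le:
  fixes v x y :: "'a::lattice_ab_group_add"
  assumes "0 \<le> v" "0 \<le> x" "0 \<le> y"
  shows "inf v (x + y) \<le> inf v x + inf v y"
proof -
  define w where "w = inf v (x + y)"
  have "w - inf v x = sup (w - v) (w - x)"
    by (simp add: diff_inf_eq_sup add_sup_distrib_left)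
  also have "\<dots> \<le> inf v y"
  proof (intro sup_least inf_greatest)
    have wv: "w \<le> v" by (simp add: w_def)
    then have "w - v \<le> 0" by simp
    then show "w - v \<le> v" "w - v \<le> y" using assms by (meson order_trans)+
    show "w - x \<le> v" using wv assms(2) by (meson diff_le_eq add_increasing2 order_trans)
    show "w - x \<le> y" by (simp add: w_def diff_le_eq add.commute)
  qed
  finally show ?thesis
    unfolding w_def by (simp only: diff_le_eq add.commute)
qed

lemma inf_pprt_pprt_uminus:
  fixes z :: "'a::lattice_ab_group_add"
  shows "inf (pprt z) (pprt (- z)) = 0"
proof -
  have "pprt z - inf (pprt z) (pprt (- z)) = sup 0 (pprt z - pprt (- z))"
    by (simp add: diff_inf_eq_sup add_sup_distrib_left)
  also have "pprt z - pprt (- z) = z"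
    using prts[of z] by (simp add: pprt_neg)
  also have "sup 0 z = pprt z"
    by (simp add: pprt_def sup_commute)
  finally show ?thesis
    by (metis add_diff_cancel_left' diff_add_cancel diff_self)
qed

lemma pprt_diff_add_inf:
  fixes x u :: "'a::lattice_ab_group_add"
  shows "pprt (x - u) + inf x u = x"
proof -
  have "x - inf x u = pprt (x - u)"
    by (simp add: diff_inf_eq_sup add_sup_distrib_left pprt_def sup_commute)
  then show ?thesis by (simp only: diff_eq_eq)
qed

lemma le_pprt: "z \<le> pprt (z :: 'a::lattice_ab_group_add)"
  by (simp add: pprt_def)

lemma pprt_le_iff: "pprt z \<le> w \<longleftrightarrow> z \<le> w \<and> 0 \<le> (w :: 'a::lattice_ab_group_add)"
  by (simp add: pprt_def)

lemma pprt_add_le: "pprt (x + y) \<le> pprt x + pprt (y :: 'a::lattice_ab_group_add)"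
  by (simp add: pprt_le_iff add_mono le_pprt)

lemma double_le_double_iff:
  fixes x y :: "'a::lattice_ab_group_add"
  shows "x + x \<le> y + y \<longleftrightarrow> x \<le> y"
proof -
  have "x + x \<le> y + y \<longleftrightarrow> 0 \<le> (y - x) + (y - x)"
    by (simp add: algebra_simps)
  then show ?thesis by simp
qed

lemma sup_le_add:
  fixes x y :: "'a::lattice_ab_group_add"
  assumes "0 \<le> x" "0 \<le> y"
  shows "sup x y \<le> x + y"
  using assms by simp

lemma add_diff_abs_le_double_inf:
  fixes a b :: "'a::lattice_ab_group_add_abs"
  shows "a + b - \<bar>a - b\<bar> \<le> inf a b + inf a b"
proof -
  have "a \<le> b + \<bar>a - b\<bar>" "b \<le> a + \<bar>a - b\<bar>"
    using abs_ge_self[of "a - b"] abs_ge_minus_self[of "a - b"] by (simp_all add: algebra_simps)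
  then have "sup a b \<le> inf a b + \<bar>a - b\<bar>"
    unfolding add_inf_distrib_right by simp
  then show ?thesis
    using add_eq_inf_sup[of a b] by (simp add: algebra_simps)
qed

lemma abs_eq_sup_diff: "\<bar>x - y\<bar> = sup (x - y) (y - (x :: 'a::lattice_ab_group_add_abs))"
  by (simp add: abs_lattice)

text \<open>
  Over the reals, a number \<open>m \<ge> 0\<close> has distance at most \<open>e\<close> to the grid \<open>0, 2e, \<dots>, 2ne\<close>, unless
  it overshoots the last grid point.  In a Banach lattice the lower bound \<open>z\<close> of all the distances
  stands for their minimum, and distributivity replaces the choice of a nearest grid point.
\<close>

lemma le_of_le_grid_distances:
  fixes e m z :: "'a::banach_lattice"
  assumes "0 \<le> m" and "\<And>j. j \<le> n \<Longrightarrow> z \<le> \<bar>m - (2 * real j) *\<^sub>R e\<bar>"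
  shows "z \<le> sup e (m - (2 * real n) *\<^sub>R e)"
  using assms(2)
proof (induction n)
  case 0
  from 0[of 0] \<open>0 \<le> m\<close> show ?case by (simp add: le_supI2)
next
  case (Suc n)
  define c where "c = m - (2 * real n) *\<^sub>R e"
  have c': "m - (2 * real (Suc n)) *\<^sub>R e = c - (e + e)"
    by (simp add: c_def algebra_simps flip: scaleR_2)
  have "z \<le> sup e c"
    unfolding c_def using Suc by simp
  moreover have "z \<le> sup (c - (e + e)) (e + e - c)"
    using Suc.prems[of "Suc n"] by (simp only: c' abs_eq_sup_diff order_refl)
  ultimately have "z \<le> inf (sup (c - (e + e)) (e + e - c)) (sup e c)"
    by simp
  also have "\<dots> \<le> sup e (inf c (sup (c - (e + e)) (e + e - c)))"
    unfolding inf_sup_distrib_lattice_group[of _ e c] by (intro sup_mono) (simp_all add: inf_commute)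
  also have "\<dots> \<le> sup e (c - (e + e))"
  proof (rule sup_least)
    have "inf c (e + e - c) + inf c (e + e - c) \<le> c + (e + e - c)"
      by (intro add_mono inf_le1 inf_le2)
    then have "inf c (e + e - c) \<le> e" by (simp add: double_le_double_iff)
    then show "inf c (sup (c - (e + e)) (e + e - c)) \<le> sup e (c - (e + e))"
      unfolding inf_sup_distrib_lattice_group
      by (intro sup_least) (simp_all add: le_supI1 le_supI2 le_infI2)
  qed simp
  finally show ?case
    by (simp only: c')
qed

lemma norm_mono_nonneg:
  fixes x y :: "'a::banach_lattice"
  assumes "0 \<le> x" "x \<le> y"
  shows "norm x \<le> norm y"
  using assms by (intro norm_lattice_mono) (simp add: abs_of_nonneg order_trans)

lemma norm_abs: "norm \<bar>x :: 'a::banach_lattice\<bar> = norm x"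
  by (intro antisym norm_lattice_mono) simp_all

lemma pprt_scaleR_le:
  fixes x :: "'a::banach_lattice"
  assumes "0 \<le> c"
  shows "pprt (c *\<^sub>R x) \<le> c *\<^sub>R pprt x"
  using assms by (simp add: pprt_le_iff scaleR_left_mono le_pprt scaleR_nonneg_nonneg)

lemma pprt_le_abs: "pprt x \<le> \<bar>x :: 'a::lattice_ab_group_add_abs\<bar>"
  by (simp add: pprt_le_iff abs_ge_self)

text \<open>
  The positive cone is closed, because \<open>pprt (a - l)\<close> is dominated by \<open>\<bar>X n - l\<bar>\<close>.
\<close>

lemma tendsto_ge_banach_lattice:
  fixes X :: "nat \<Rightarrow> 'a::banach_lattice"
  assumes "X \<longlonglongrightarrow> l" "\<And>n. a \<le> X n"
  shows "a \<le> l"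
proof -
  have "norm (pprt (a - l)) \<le> norm (X n - l)" for n
  proof -
    have "pprt (a - l) \<le> pprt (X n - l)"
      using assms(2) by simp
    also have "\<dots> \<le> \<bar>X n - l\<bar>" by (rule pprt_le_abs)
    finally show ?thesis
      using norm_mono_nonneg norm_abs zero_le_pprt by metis
  qed
  moreover have "(\<lambda>n. norm (X n - l)) \<longlonglongrightarrow> 0"
    using assms(1) by (simp add: LIM_zero tendsto_norm_zero)
  ultimately have "norm (pprt (a - l)) \<le> 0"
    by (intro LIMSEQ_le_const) auto
  then have "pprt (a - l) = 0" by simp
  then show ?thesis using le_pprt[of "a - l"] by simp
qed

lemma tendsto_le_banach_lattice:
  fixes X :: "nat \<Rightarrow> 'a::banach_lattice"
  assumes "X \<longlonglongrightarrow> l" "\<And>n. X n \<le> a"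
  shows "l \<le> a"
  using tendsto_ge_banach_lattice[OF tendsto_minus[OF assms(1)], of "- a"] assms(2) by simp

section \<open>Positive functionals\<close>

text \<open>
  A linear functional below \<open>x \<mapsto> norm (pprt x)\<close> is automatically positive, since this sublinear
  functional vanishes on the negative cone.
\<close>

lemma positive_norming_functional:
  fixes b :: "'a::banach_lattice"
  assumes "0 \<le> b"
  obtains f :: "'a \<Rightarrow> real"
  where "bounded_linear f" "\<And>x. 0 \<le> x \<Longrightarrow> 0 \<le> f x" "\<And>x. \<bar>f x\<bar> \<le> norm x" "f b = norm b"
proof -
  have sub: "sublinear (\<lambda>x :: 'a. norm (pprt x))"
    unfolding sublinear_def
  proof (intro conjI allI impI)
    fix x y :: 'a
    show "norm (pprt (x + y)) \<le> norm (pprt x) + norm (pprt y)"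
      using norm_mono_nonneg[OF zero_le_pprt pprt_add_le] norm_triangle_ineq by (rule order_trans)
  next
    fix c :: real and x :: 'a assume "0 \<le> c"
    then show "norm (pprt (c *\<^sub>R x)) \<le> c * norm (pprt x)"
      using norm_mono_nonneg[OF zero_le_pprt pprt_scaleR_le, of c x] by simp
  qed
  obtain f :: "'a \<Rightarrow> real" where f: "linear f" "f \<le> (\<lambda>x. norm (pprt x))" "f b = norm (pprt b)"
    using Hahn_Banach_support[OF sub] .
  have le: "f x \<le> norm (pprt x)" for x
    using f(2) by (simp add: le_fun_def)
  have le_norm: "f x \<le> norm x" for x
    using le[of x] norm_mono_nonneg[OF zero_le_pprt pprt_le_abs, of x] by (simp add: norm_abs)
  have neg: "f (- x) = - f x" for x
    using f(1) by (rule linear_neg)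
  have abs: "\<bar>f x\<bar> \<le> norm x" for x
    using le_norm[of x] le_norm[of "- x"] by (simp add: neg)
  show thesis
  proof (rule that)
    show "bounded_linear f"
      by (rule bounded_linear_intro[where K = 1])
        (use f(1) abs in \<open>simp_all add: linear_add linear_scale\<close>)
    show "0 \<le> f x" if "0 \<le> x" for x
      using le[of "- x"] that by (simp add: neg)
    show "\<bar>f x\<bar> \<le> norm x" for x by (rule abs)
    show "f b = norm b" using f(3) assms by simp
  qed
qed

text \<open>
  The functional is \<open>\<Sum>n. (1/2) ^ n * f n x\<close>.  It reduces smallness with respect to countably many
  positive functionals to smallness with respect to a single one.
\<close>

lemma dominating_positive_functional:
  fixes f :: "nat \<Rightarrow> 'a::banach_lattice \<Rightarrow> real"
  assumes lin: "\<And>n. bounded_linear (f n)"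
    and pos: "\<And>n x. 0 \<le> x \<Longrightarrow> 0 \<le> f n x"
    and bound: "\<And>n x. \<bar>f n x\<bar> \<le> norm x"
  obtains g :: "'a \<Rightarrow> real"
  where "bounded_linear g" "\<And>x. 0 \<le> x \<Longrightarrow> 0 \<le> g x" "\<And>n x. 0 \<le> x \<Longrightarrow> f n x \<le> 2 ^ n * g x"
proof -
  define g where "g x = (\<Sum>n. (1/2) ^ n * f n x)" for x
  have dom: "norm ((1/2) ^ n * f n x) \<le> (1/2) ^ n * norm x" for n x
    using bound[of n x] by (simp add: abs_mult mult_left_mono)
  have geom: "summable (\<lambda>n. (1/2) ^ n * norm x)" for x :: 'a
    by (intro summable_mult2 summable_geometric) simp
  have summ: "summable (\<lambda>n. (1/2) ^ n * f n x)" for x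
    by (rule summable_comparison_test'[OF geom[of x], where N = 0]) (rule dom)
  show thesis
  proof (rule that)
    show "bounded_linear g"
    proof (rule bounded_linear_intro[where K = 2])
      show "g (x + y) = g x + g y" for x y
        unfolding g_def using suminf_add[OF summ summ, of x y]
        by (simp add: linear_add[OF bounded_linear.linear[OF lin]] distrib_left)
      show "g (r *\<^sub>R x) = r *\<^sub>R g x" for r x
        unfolding g_def using suminf_mult[OF summ, of r x]
        by (simp add: linear_scale[OF bounded_linear.linear[OF lin]] mult.left_commute)
      show "norm (g x) \<le> norm x * 2" for x
      proof -
        have "norm (g x) \<le> (\<Sum>n. (1/2) ^ n * norm x)"
          unfolding g_def by (rule norm_suminf_le[OF _ geom]) (rule dom)
        also have "\<dots> = norm x * 2"
          using suminf_mult2[of "\<lambda>n. (1/2 :: real) ^ n" "norm x"]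
          by (simp add: suminf_geometric summable_geometric)
        finally show ?thesis .
      qed
    qed
    show "0 \<le> g x" if "0 \<le> x" for x
      unfolding g_def using that pos by (intro suminf_nonneg summ) simp
    show "f n x \<le> 2 ^ n * g x" if "0 \<le> x" for n x
    proof -
      have "(\<Sum>i\<in>{n}. (1/2) ^ i * f i x) \<le> g x"
        unfolding g_def using that pos by (intro sum_le_suminf summ) auto
      then show ?thesis by (simp add: field_simps power_divide)
    qed
  qed
qed

lemma positive_functional_mono:
  fixes f :: "'a::banach_lattice \<Rightarrow> real"
  assumes "bounded_linear f" "\<And>x. 0 \<le> x \<Longrightarrow> 0 \<le> f x" "x \<le> y"
  shows "f x \<le> f y"
  using assms(2)[of "y - x"] assms(3) linear_diff[OF bounded_linear.linear[OF assms(1)], of y x]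
  by simp

section \<open>L-weakly compact order intervals\<close>

lemma disjoint_sequence_mono:
  assumes "disjoint_sequence v" "\<And>n. \<bar>w n\<bar> \<le> \<bar>v n\<bar>"
  shows "disjoint_sequence w"
  unfolding disjoint_sequence_def
proof (intro allI impI antisym)
  fix m n :: nat assume "m \<noteq> n"
  have "inf \<bar>w m\<bar> \<bar>w n\<bar> \<le> inf \<bar>v m\<bar> \<bar>v n\<bar>"
    using assms(2) by (intro inf_mono)
  also have "\<dots> = 0"
    using assms(1) \<open>m \<noteq> n\<close> by (simp add: disjoint_sequence_def)
  finally show "inf \<bar>w m\<bar> \<bar>w n\<bar> \<le> 0" .
qed simp

lemma disjoint_sequenceI_nonneg:
  fixes v :: "nat \<Rightarrow> 'a::banach_lattice"
  assumes "\<And>n. 0 \<le> v n" "\<And>m n. m < n \<Longrightarrow> inf (v m) (v n) \<le> 0"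
  shows "disjoint_sequence v"
proof -
  have "inf (v m) (v n) \<le> 0" if "m \<noteq> n" for m n
    using assms(2)[of m n] assms(2)[of n m] that by (cases m n rule: linorder_cases) (simp_all add: inf_commute)
  then have "inf (v m) (v n) = 0" if "m \<noteq> n" for m n
    using assms(1) that by (intro antisym) simp_all
  then show ?thesis
    using assms(1) by (simp add: disjoint_sequence_def)
qed

lemma L_weakly_compactD:
  assumes "L_weakly_compact A" "disjoint_sequence v" "\<And>n. v n \<in> solid_hull A"
  shows "(\<lambda>n. norm (v n)) \<longlonglongrightarrow> 0"
  using assms unfolding L_weakly_compact_def by blast

lemma L_weakly_compact_mono:
  assumes "L_weakly_compact B" "A \<noteq> {}" "A \<subseteq> solid_hull B"
  shows "L_weakly_compact A"
  unfolding L_weakly_compact_def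
proof (intro conjI allI impI)
  obtain K where K: "\<And>b. b \<in> B \<Longrightarrow> norm b \<le> K"
    using assms(1) unfolding L_weakly_compact_def bounded_iff by blast
  have "norm a \<le> K" if "a \<in> A" for a
    using that assms(3) K norm_lattice_mono unfolding solid_hull_def by (blast intro: order_trans)
  then show "bounded A" unfolding bounded_iff by blast
  fix v :: "nat \<Rightarrow> 'a" assume v: "disjoint_sequence v \<and> range v \<subseteq> solid_hull A"
  have "solid_hull A \<subseteq> solid_hull B"
    using assms(3) unfolding solid_hull_def by (blast intro: order_trans)
  with v show "(\<lambda>n. norm (v n)) \<longlonglongrightarrow> 0"
    using L_weakly_compactD[OF assms(1)] by blast
qed fact

lemma L_weakly_compact_intervalI:
  fixes u :: "'a::banach_lattice"
  assumes "0 \<le> u"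
    and lim: "\<And>v. disjoint_sequence v \<Longrightarrow> (\<And>n. 0 \<le> v n) \<Longrightarrow> (\<And>n. v n \<le> u) \<Longrightarrow> (\<lambda>n. norm (v n)) \<longlonglongrightarrow> 0"
  shows "L_weakly_compact {0..u}"
  unfolding L_weakly_compact_def
proof (intro conjI allI impI)
  show "{0..u} \<noteq> {}" using \<open>0 \<le> u\<close> by simp
  show "bounded {0..u}"
    unfolding bounded_iff by (intro exI[of _ "norm u"] ballI norm_mono_nonneg) simp_all
  fix v :: "nat \<Rightarrow> 'a" assume v: "disjoint_sequence v \<and> range v \<subseteq> solid_hull {0..u}"
  have "\<bar>v n\<bar> \<le> u" for n
  proof -
    have "v n \<in> solid_hull {0..u}" using v by blast
    then obtain a where "0 \<le> a" "a \<le> u" "\<bar>v n\<bar> \<le> \<bar>a\<bar>"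
      unfolding solid_hull_def by auto
    then show ?thesis by simp
  qed
  moreover have "disjoint_sequence (\<lambda>n. \<bar>v n\<bar>)"
    using v by (intro disjoint_sequence_mono[of v "\<lambda>n. \<bar>v n\<bar>"]) simp_all
  ultimately have "(\<lambda>n. norm \<bar>v n\<bar>) \<longlonglongrightarrow> 0"
    by (intro lim) simp_all
  then show "(\<lambda>n. norm (v n)) \<longlonglongrightarrow> 0" by (simp add: norm_abs)
qed

lemma L_weakly_compact_intervalD:
  fixes u :: "'a::banach_lattice"
  assumes "L_weakly_compact {0..u}" "disjoint_sequence v" "\<And>n. 0 \<le> v n" "\<And>n. v n \<le> u"
  shows "(\<lambda>n. norm (v n)) \<longlonglongrightarrow> 0"
  using assms(1,2)
proof (rule L_weakly_compactD)
  show "v n \<in> solid_hull {0..u}" for n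
    using assms(3,4) unfolding solid_hull_def by (intro CollectI bexI[of _ "v n"]) auto
qed

lemma L_weakly_compact_interval_element:
  assumes "L_weakly_compact A" "a \<in> A" "0 \<le> a"
  shows "L_weakly_compact {0..a}"
  using assms(1)
proof (rule L_weakly_compact_mono)
  show "{0..a} \<noteq> {}" using assms(3) by simp
  show "{0..a} \<subseteq> solid_hull A"
    using assms(2,3) unfolding solid_hull_def by (intro subsetI CollectI bexI[of _ a]) auto
qed

text \<open>
  A disjoint sequence below \<open>u + w\<close> is dominated by the sum of its truncations at \<open>u\<close> and at \<open>w\<close>,
  which are disjoint too.
\<close>

lemma L_weakly_compact_interval_add:
  fixes u w :: "'a::banach_lattice"
  assumes "L_weakly_compact {0..u}" "L_weakly_compact {0..w}"
  shows "L_weakly_compact {0..u + w}"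
proof -
  have pos: "0 \<le> u" "0 \<le> w"
    using assms by (simp_all add: L_weakly_compact_def)
  show ?thesis
  proof (rule L_weakly_compact_intervalI)
    show "0 \<le> u + w" using pos by simp
    fix v :: "nat \<Rightarrow> 'a"
    assume v: "disjoint_sequence v" "\<And>n. 0 \<le> v n" "\<And>n. v n \<le> u + w"
    have part: "(\<lambda>n. norm (inf (v n) t)) \<longlonglongrightarrow> 0" if "L_weakly_compact {0..t}" "0 \<le> t" for t
    proof (rule L_weakly_compact_intervalD[OF that(1)])
      show "disjoint_sequence (\<lambda>n. inf (v n) t)"
        using v(1) by (rule disjoint_sequence_mono) (use v(2) that(2) in simp)
    qed (use v(2) that(2) in simp_all)
    have le: "norm (v n) \<le> norm (inf (v n) u) + norm (inf (v n) w)" for n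
    proof -
      have "v n = inf (v n) (u + w)"
        using v(3) by (simp add: inf_absorb1)
      also have "\<dots> \<le> inf (v n) u + inf (v n) w"
        using v(2) pos by (intro inf_add_le)
      finally have "norm (v n) \<le> norm (inf (v n) u + inf (v n) w)"
        by (rule norm_mono_nonneg[OF v(2)])
      then show ?thesis
        using norm_triangle_ineq by (rule order_trans)
    qed
    have lim: "(\<lambda>n. norm (inf (v n) u) + norm (inf (v n) w)) \<longlonglongrightarrow> 0"
      using tendsto_add[OF part[OF assms(1) pos(1)] part[OF assms(2) pos(2)]] by simp
    show "(\<lambda>n. norm (v n)) \<longlonglongrightarrow> 0"
      by (rule Lim_null_comparison[OF always_eventually lim]) (simp add: le)
  qed
qed

lemma L_weakly_compact_interval_sum:
  fixes a :: "'i \<Rightarrow> 'a::banach_lattice"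
  assumes "finite I" "\<And>i. i \<in> I \<Longrightarrow> L_weakly_compact {0..a i}"
  shows "L_weakly_compact {0..\<Sum>i\<in>I. a i}"
  using assms
proof (induction I)
  case empty
  have "L_weakly_compact {0 :: 'a..0}"
  proof (rule L_weakly_compact_intervalI)
    fix v :: "nat \<Rightarrow> 'a"
    assume "\<And>n. 0 \<le> v n" "\<And>n. v n \<le> 0"
    then have "v n = 0" for n by (meson antisym)
    then show "(\<lambda>n. norm (v n)) \<longlonglongrightarrow> 0" by simp
  qed simp
  then show ?case by simp
qed (simp add: L_weakly_compact_interval_add)

lemma L_weakly_compact_interval_scaleR_of_nat:
  fixes u :: "'a::banach_lattice"
  assumes "L_weakly_compact {0..u}"
  shows "L_weakly_compact {0..real n *\<^sub>R u}"
  using L_weakly_compact_interval_sum[of "{..<n}" "\<lambda>_. u"] assms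
  by (simp add: sum_constant_scaleR)

section \<open>Norm convergence of monotone sequences\<close>

text \<open>
  If \<open>s n\<close> and \<open>s (Suc n)\<close> lie strictly on different sides of a level \<open>t\<close>, then for no other index does \<open>s\<close>
  cross \<open>t\<close>; this is the source of disjoint sequences in \<open>{0..u}\<close>.  The level nearest
  to the midpoint of \<open>s n\<close> and \<open>s (Suc n)\<close> detects the increment up to the mesh \<open>e\<close> of the
  grid of levels.
\<close>

lemma increments_tendsto_0:
  fixes s :: "nat \<Rightarrow> 'a::banach_lattice"
  assumes L: "L_weakly_compact {0..u}" and s: "mono s" "\<And>n. 0 \<le> s n" "\<And>n. s n \<le> u"
  shows "(\<lambda>n. norm (s (Suc n) - s n)) \<longlonglongrightarrow> 0"
proof (rule LIMSEQ_I)
  fix \<epsilon> :: real assume "0 < \<epsilon>"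
  have u: "0 \<le> u" using s(2,3) by (meson order_trans)
  obtain N :: nat where N: "norm u / (\<epsilon> / 2) < real N"
    using reals_Archimedean2 by blast
  then have "N > 0"
    using \<open>0 < \<epsilon>\<close> by (metis divide_nonneg_pos half_gt_zero norm_ge_zero not_gr_zero not_le of_nat_0)
  \<comment> \<open>The levels are the multiples of \<open>e\<close> up to \<open>N\<close> times \<open>e\<close>, which is \<open>u\<close>; \<open>N\<close> makes \<open>norm e\<close> small.\<close>
  define e where "e = (1 / real N) *\<^sub>R u"
  define v where "v j n = inf (pprt (s (Suc n) - real j *\<^sub>R e)) (pprt (real j *\<^sub>R e - s n))" for j n
  have e: "0 \<le> e" unfolding e_def using u by (simp add: scaleR_nonneg_nonneg)
  have v_nonneg: "0 \<le> v j n" for j n by (simp add: v_def)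
  have v_null: "(\<lambda>n. norm (v j n)) \<longlonglongrightarrow> 0" for j
  proof (rule L_weakly_compact_intervalD[OF L _ v_nonneg])
    show "disjoint_sequence (v j)"
    proof (rule disjoint_sequenceI_nonneg)
      fix m n :: nat assume "m < n"
      then have "s (Suc m) \<le> s n" using s(1) by (simp add: mono_def)
      then have "pprt (s (Suc m) - real j *\<^sub>R e) \<le> pprt (- (real j *\<^sub>R e - s n))"
        by simp
      then have "inf (v j m) (v j n) \<le> inf (pprt (- (real j *\<^sub>R e - s n))) (pprt (real j *\<^sub>R e - s n))"
        unfolding v_def by (intro inf_mono) (auto intro: le_infI1)
      then show "inf (v j m) (v j n) \<le> 0"
        by (simp only: inf_commute inf_pprt_pprt_uminus)
    qed (rule v_nonneg)
    show "v j n \<le> u" for n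
    proof -
      have "0 \<le> real j *\<^sub>R e" using e by (simp add: scaleR_nonneg_nonneg)
      then have "s (Suc n) - real j *\<^sub>R e \<le> s (Suc n)" by simp
      also have "\<dots> \<le> u" by (rule s(3))
      finally have "pprt (s (Suc n) - real j *\<^sub>R e) \<le> u" using u by (simp add: pprt_le_iff)
      then show ?thesis unfolding v_def by (rule le_infI1)
    qed
  qed
  define V where "V n = (\<Sum>j\<le>N. v j n)" for n
  have bound: "s (Suc n) - s n \<le> e + (V n + V n)" for n
  proof -
    \<comment> \<open>Twice the infimum of \<open>a\<close> and \<open>b\<close> is at least \<open>a + b\<close> minus their distance; here \<open>a + b\<close> is the increment.\<close>
    have "s (Suc n) - s n - (V n + V n) \<le> \<bar>(s (Suc n) + s n) - (2 * real j) *\<^sub>R e\<bar>" if "j \<le> N" for j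
    proof -
      define a where "a = s (Suc n) - real j *\<^sub>R e"
      define b where "b = real j *\<^sub>R e - s n"
      have "inf a b \<le> v j n"
        unfolding v_def a_def b_def by (intro inf_mono le_pprt)
      also have "\<dots> \<le> V n"
        unfolding V_def using that v_nonneg sum_mono2[of "{..N}" "{j}" "\<lambda>j. v j n"] by simp
      finally have "inf a b + inf a b \<le> V n + V n"
        by (intro add_mono)
      with add_diff_abs_le_double_inf[of a b] have "a + b - \<bar>a - b\<bar> \<le> V n + V n"
        by (rule order_trans)
      then have "a + b - (V n + V n) \<le> \<bar>a - b\<bar>"
        by (simp only: diff_le_eq add.commute)
      moreover have "a + b = s (Suc n) - s n" "a - b = (s (Suc n) + s n) - (2 * real j) *\<^sub>R e"
        by (simp_all add: a_def b_def algebra_simps flip: scaleR_2)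
      ultimately show ?thesis by simp
    qed
    then have "s (Suc n) - s n - (V n + V n) \<le> sup e ((s (Suc n) + s n) - (2 * real N) *\<^sub>R e)"
      using s(2) by (intro le_of_le_grid_distances) simp_all
    also have "\<dots> \<le> e"
    proof (rule sup_least)
      have "(2 * real N) *\<^sub>R e = u + u"
        using \<open>N > 0\<close> by (simp add: e_def scaleR_2)
      then have "(s (Suc n) + s n) - (2 * real N) *\<^sub>R e \<le> 0"
        using add_mono[OF s(3)[of "Suc n"] s(3)[of n]] by simp
      then show "(s (Suc n) + s n) - (2 * real N) *\<^sub>R e \<le> e"
        using e by (rule order_trans)
    qed simp
    finally show ?thesis by (simp only: diff_le_eq)
  qed
  have "norm e < \<epsilon> / 2"
    using N \<open>N > 0\<close> \<open>0 < \<epsilon>\<close> by (simp add: e_def field_simps)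
  have "(\<lambda>n. 2 * (\<Sum>j\<le>N. norm (v j n))) \<longlonglongrightarrow> 2 * (\<Sum>j\<le>N. 0)"
    by (intro tendsto_intros v_null)
  then have "\<forall>\<^sub>F n in sequentially. 2 * (\<Sum>j\<le>N. norm (v j n)) < \<epsilon> / 2"
    by (rule order_tendstoD(2)) (simp add: \<open>0 < \<epsilon>\<close>)
  then obtain n0 where n0: "\<And>n. n \<ge> n0 \<Longrightarrow> 2 * (\<Sum>j\<le>N. norm (v j n)) < \<epsilon> / 2"
    unfolding eventually_sequentially by blast
  have "norm (s (Suc n) - s n) < \<epsilon>" if "n \<ge> n0" for n
  proof -
    have "0 \<le> s (Suc n) - s n" using s(1) by (simp add: mono_def)
    then have "norm (s (Suc n) - s n) \<le> norm (e + (V n + V n))"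
      using bound by (rule norm_mono_nonneg)
    also have "\<dots> \<le> norm e + (norm (V n) + norm (V n))"
      using norm_triangle_ineq[of e "V n + V n"] norm_triangle_ineq[of "V n" "V n"] by simp
    also have "norm (V n) \<le> (\<Sum>j\<le>N. norm (v j n))"
      unfolding V_def by (rule norm_sum)
    finally show ?thesis
      using n0[OF that] \<open>norm e < \<epsilon> / 2\<close> by simp
  qed
  then show "\<exists>n0. \<forall>n\<ge>n0. norm (norm (s (Suc n) - s n) - 0) < \<epsilon>"
    by auto
qed

text \<open>
  The previous lemma also applies to all subsequences of \<open>s\<close>, and a sequence all of whose
  subsequences have increments tending to zero is Cauchy.
\<close>

lemma increasing_order_bounded_convergent:
  fixes s :: "nat \<Rightarrow> 'a::banach_lattice"
  assumes L: "L_weakly_compact {0..u}" and s: "mono s" "\<And>n. 0 \<le> s n" "\<And>n. s n \<le> u"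
  shows "convergent s"
proof (rule Cauchy_convergent, rule ccontr)
  assume "\<not> Cauchy s"
  have "\<exists>\<epsilon>>0. \<forall>M. \<exists>n\<ge>M. \<epsilon> \<le> norm (s n - s M)"
  proof (rule ccontr)
    assume "\<not> ?thesis"
    then have small: "\<exists>M. \<forall>n\<ge>M. norm (s n - s M) < \<epsilon>" if "\<epsilon> > 0" for \<epsilon>
      using that by (meson not_le)
    have "Cauchy s"
    proof (rule CauchyI)
      fix \<epsilon> :: real assume "\<epsilon> > 0"
      with small[of "\<epsilon> / 2"] obtain M where M: "\<And>n. n \<ge> M \<Longrightarrow> norm (s n - s M) < \<epsilon> / 2" by auto
      have "norm (s m - s n) < \<epsilon>" if "m \<ge> M" "n \<ge> M" for m n
        using norm_triangle_ineq4[of "s m - s M" "s n - s M"] M[OF that(1)] M[OF that(2)] by simp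
      then show "\<exists>M. \<forall>m\<ge>M. \<forall>n\<ge>M. norm (s m - s n) < \<epsilon>" by blast
    qed
    with \<open>\<not> Cauchy s\<close> show False ..
  qed
  then obtain \<epsilon> \<sigma> where \<epsilon>: "\<epsilon> > 0" and \<sigma>: "\<And>M. \<sigma> M \<ge> M" "\<And>M. \<epsilon> \<le> norm (s (\<sigma> M) - s M)"
    by metis
  define r where "r k = (\<sigma> ^^ k) 0" for k
  have "(\<lambda>k. norm (s (r (Suc k)) - s (r k))) \<longlonglongrightarrow> 0"
  proof (rule increments_tendsto_0[OF L])
    have "mono r"
      unfolding mono_iff_le_Suc r_def using \<sigma>(1) by simp
    then show "mono (\<lambda>k. s (r k))"
      using s(1) by (simp add: mono_def)
  qed (rule s)+
  then have "\<epsilon> \<le> 0"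
    using \<sigma>(2) by (intro LIMSEQ_le_const) (auto simp: r_def)
  with \<epsilon> show False by simp
qed

section \<open>Order bounded sequences that positive functionals send to zero\<close>

text \<open>
  The supremum of \<open>c k, \<dots>, c (k + m)\<close>, which increases with \<open>m\<close> towards the supremum of the
  \<open>k\<close>-th tail.
\<close>

fun running_sup :: "(nat \<Rightarrow> 'a::lattice) \<Rightarrow> nat \<Rightarrow> nat \<Rightarrow> 'a" where
  "running_sup c k 0 = c k"
| "running_sup c k (Suc m) = sup (running_sup c k m) (c (k + Suc m))"

lemma running_sup_ge: "c k \<le> running_sup c k m"
  by (induction m) (auto intro: le_supI1)

lemma mono_running_sup: "mono (running_sup c k)"
  by (simp add: mono_iff_le_Suc)

lemma running_sup_le: "(\<And>n. c n \<le> u) \<Longrightarrow> running_sup c k m \<le> u"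
  by (induction m) auto

lemma running_sup_Suc_start: "running_sup c (Suc k) m \<le> running_sup c k (Suc m)"
proof (induction m)
  case (Suc m)
  then show ?case
    by (simp only: running_sup.simps add_Suc_right add_Suc) (rule sup_mono, simp_all)
qed simp

text \<open>
  Along terms \<open>c k\<close> that \<open>g\<close> sends to zero summably fast, the tail suprema \<open>e k\<close> exist as norm
  limits, and their decreasing limit \<open>h\<close> satisfies \<open>g h = 0\<close>.  So \<open>h\<close> is invisible to every norming
  functional, although the one of \<open>c k\<close> is bounded below at \<open>e k \<ge> c k\<close>.
\<close>

lemma order_bounded_weakly_null_norm_null:
  fixes b :: "nat \<Rightarrow> 'a::banach_lattice"
  assumes L: "L_weakly_compact {0..u}"
    and b: "\<And>n. 0 \<le> b n" "\<And>n. b n \<le> u"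
    and null: "\<And>g :: 'a \<Rightarrow> real. bounded_linear g \<Longrightarrow> (\<And>x. 0 \<le> x \<Longrightarrow> 0 \<le> g x) \<Longrightarrow> (\<lambda>n. g (b n)) \<longlonglongrightarrow> 0"
  shows "(\<lambda>n. norm (b n)) \<longlonglongrightarrow> 0"
proof (rule ccontr)
  assume "\<not> ?thesis"
  then obtain \<epsilon> where \<epsilon>: "\<epsilon> > 0" and freq: "\<And>M. \<exists>n\<ge>M. \<epsilon> \<le> norm (b n)"
    unfolding lim_sequentially by (auto simp: not_less)
  have "\<exists>f :: 'a \<Rightarrow> real. bounded_linear f \<and> (\<forall>x. 0 \<le> x \<longrightarrow> 0 \<le> f x) \<and>
      (\<forall>x. \<bar>f x\<bar> \<le> norm x) \<and> f (b n) = norm (b n)" for n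
    by (rule positive_norming_functional[OF b(1)[of n]]) (intro exI conjI allI impI)
  then have "\<forall>n. \<exists>f :: 'a \<Rightarrow> real. bounded_linear f \<and> (\<forall>x. 0 \<le> x \<longrightarrow> 0 \<le> f x) \<and>
      (\<forall>x. \<bar>f x\<bar> \<le> norm x) \<and> f (b n) = norm (b n)"
    by (rule allI)
  from choice[OF this] obtain f :: "nat \<Rightarrow> 'a \<Rightarrow> real" where
    F: "\<forall>n. bounded_linear (f n) \<and> (\<forall>x. 0 \<le> x \<longrightarrow> 0 \<le> f n x) \<and>
      (\<forall>x. \<bar>f n x\<bar> \<le> norm x) \<and> f n (b n) = norm (b n)" ..
  have f: "\<And>n. bounded_linear (f n)" "\<And>n x. 0 \<le> x \<Longrightarrow> 0 \<le> f n x"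
      "\<And>n x. \<bar>f n x\<bar> \<le> norm x" "\<And>n. f n (b n) = norm (b n)"
    using F by simp_all
  obtain g where g: "bounded_linear g" "\<And>x. 0 \<le> x \<Longrightarrow> 0 \<le> g x" and fg: "\<And>n x. 0 \<le> x \<Longrightarrow> f n x \<le> 2 ^ n * g x"
    by (rule dominating_positive_functional[of f]) (use f(1,2,3) in simp_all)
  have g_mono: "g x \<le> g y" if "x \<le> y" for x y
    using g that by (rule positive_functional_mono)
  have "\<exists>n. \<epsilon> \<le> norm (b n) \<and> g (b n) \<le> (1/2) ^ k" for k
  proof -
    have "\<forall>\<^sub>F n in sequentially. g (b n) < (1/2) ^ k"
      by (rule order_tendstoD(2)[OF null[OF g]]) simp_all
    then show ?thesis
      using freq unfolding eventually_sequentially by (meson less_imp_le)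
  qed
  then obtain r where r: "\<And>k. \<epsilon> \<le> norm (b (r k))" "\<And>k. g (b (r k)) \<le> (1/2) ^ k"
    by metis
  define c where "c k = b (r k)" for k
  define d where "d = running_sup c"
  have d_ge: "c k \<le> d k m" for k m
    unfolding d_def by (rule running_sup_ge)
  have d_le: "d k m \<le> u" for k m
    unfolding d_def by (rule running_sup_le) (simp add: c_def b(2))
  have d_nonneg: "0 \<le> d k m" for k m
    using d_ge[of k m] b(1) by (metis c_def order_trans)
  have d_mono: "mono (d k)" for k
    unfolding d_def by (rule mono_running_sup)
  \<comment> \<open>The bound is the geometric sum of \<open>(1/2) ^ i\<close> over \<open>k \<le> i \<le> k + m\<close>.\<close>
  have g_d: "g (d k m) \<le> 2 * (1/2) ^ k - (1/2) ^ (k + m)" for k m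
  proof (induction m)
    case 0
    then show ?case using r(2)[of k] by (simp add: d_def c_def)
  next
    case (Suc m)
    have "d k (Suc m) \<le> d k m + c (k + Suc m)"
      using sup_le_add[OF d_nonneg[of k m], of "c (k + Suc m)"] b(1) by (simp add: d_def c_def)
    then have "g (d k (Suc m)) \<le> g (d k m) + g (c (k + Suc m))"
      using g_mono linear_add[OF bounded_linear.linear[OF g(1)]] by metis
    then show ?case
      using Suc.IH r(2)[of "k + Suc m"] by (simp add: c_def)
  qed
  have "\<forall>k. \<exists>e. d k \<longlonglongrightarrow> e"
    using increasing_order_bounded_convergent[OF L d_mono d_nonneg d_le] by (simp add: convergent_def)
  then obtain e where e: "\<And>k. d k \<longlonglongrightarrow> e k"
    by metis
  have d_le_e: "d k m \<le> e k" for k m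
  proof (rule tendsto_ge_banach_lattice)
    show "(\<lambda>i. d k (i + m)) \<longlonglongrightarrow> e k"
      using e by (rule LIMSEQ_ignore_initial_segment)
    show "d k m \<le> d k (i + m)" for i
      using d_mono by (simp add: mono_def)
  qed
  have e_nonneg: "0 \<le> e k" and e_le: "e k \<le> u" for k
    using tendsto_ge_banach_lattice[OF e d_nonneg] tendsto_le_banach_lattice[OF e d_le] .
  have e_Suc: "e (Suc k) \<le> e k" for k
  proof (rule tendsto_le_banach_lattice[OF e])
    fix m
    have "d (Suc k) m \<le> d k (Suc m)"
      unfolding d_def by (rule running_sup_Suc_start)
    then show "d (Suc k) m \<le> e k" using d_le_e by (rule order_trans)
  qed
  have g_e: "g (e k) \<le> 2 * (1/2) ^ k" for k
  proof (rule LIMSEQ_le_const2)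
    show "(\<lambda>m. g (d k m)) \<longlonglongrightarrow> g (e k)"
      using bounded_linear.tendsto[OF g(1) e] .
    show "\<exists>N. \<forall>m\<ge>N. g (d k m) \<le> 2 * (1/2) ^ k"
      by (intro exI allI impI order_trans[OF g_d]) simp
  qed
  have "convergent (\<lambda>k. u - e k)"
    using e_nonneg e_le e_Suc
    by (intro increasing_order_bounded_convergent[OF L]) (simp_all add: mono_iff_le_Suc)
  then obtain w where w: "(\<lambda>k. u - e k) \<longlonglongrightarrow> w"
    unfolding convergent_def by blast
  \<comment> \<open>The decreasing sequence \<open>e\<close> converges because \<open>u - e k\<close> increases.\<close>
  define h where "h = u - w"
  have h: "e \<longlonglongrightarrow> h"
    using tendsto_diff[OF tendsto_const[of u] w] by (simp add: h_def)
  have h_nonneg: "0 \<le> h"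
    using h e_nonneg by (rule tendsto_ge_banach_lattice)
  have "g h \<le> 0"
  proof (rule LIMSEQ_le)
    show "(\<lambda>k. g (e k)) \<longlonglongrightarrow> g h"
      using bounded_linear.tendsto[OF g(1) h] .
    show "(\<lambda>k. 2 * (1/2) ^ k :: real) \<longlonglongrightarrow> 0"
      by (intro tendsto_mult_right_zero LIMSEQ_power_zero) simp
  qed (use g_e in blast)
  have f_h: "f n h \<le> 0" for n
  proof -
    have "f n h \<le> 2 ^ n * g h" using h_nonneg by (rule fg)
    also have "\<dots> \<le> 0" using \<open>g h \<le> 0\<close> by (simp add: mult_nonneg_nonpos)
    finally show ?thesis .
  qed
  have "\<epsilon> \<le> norm (e k - h)" for k
  proof -
    have "\<epsilon> \<le> f (r k) (c k)"
      using r(1) f(4) by (simp add: c_def)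
    also have "\<dots> \<le> f (r k) (e k)"
      using f(1,2) order_trans[OF d_ge d_le_e] by (rule positive_functional_mono)
    also have "\<dots> = f (r k) (e k - h) + f (r k) h"
      by (simp add: linear_diff[OF bounded_linear.linear[OF f(1)]])
    also have "\<dots> \<le> norm (e k - h)"
      using f(3)[of "r k" "e k - h"] f_h[of "r k"] by simp
    finally show ?thesis .
  qed
  moreover have "(\<lambda>k. norm (e k - h)) \<longlonglongrightarrow> 0"
    using h by (simp add: LIM_zero tendsto_norm_zero)
  ultimately have "\<epsilon> \<le> 0"
    by (intro LIMSEQ_le_const) auto
  with \<epsilon> show False by simp
qed

section \<open>Almost order boundedness of L-weakly compact sequences\<close>

text \<open>
  Subtracting \<open>(1/2) ^ k y\<close> with \<open>y = \<Sum>j. (1/2) ^ j c j\<close> from the \<open>k\<close>-th residual costs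
  little in norm and makes the residuals disjoint: for \<open>k < l\<close>, the \<open>l\<close>-th one lives where
  \<open>c (Suc l) > 4 ^ l c (Suc k)\<close>, and the \<open>k\<close>-th one where the reverse inequality is strict.
\<close>

lemma disjoint_residuals_null:
  fixes c :: "nat \<Rightarrow> 'a::banach_lattice"
  assumes L: "L_weakly_compact (range c)" and c: "\<And>n. 0 \<le> c n"
  shows "(\<lambda>k. norm (pprt (c (Suc k) - 4 ^ k *\<^sub>R (\<Sum>j\<le>k. c j)))) \<longlonglongrightarrow> 0"
proof -
  obtain B where B: "\<And>n. norm (c n) \<le> B"
    using L unfolding L_weakly_compact_def bounded_iff by blast
  define S where "S k = (\<Sum>j\<le>k. c j)" for k
  define y where "y = (\<Sum>j. (1/2) ^ j *\<^sub>R c j)"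
  have "summable (\<lambda>j. (1/2) ^ j *\<^sub>R c j)"
  proof (rule summable_comparison_test')
    show "summable (\<lambda>j. (1/2) ^ j * B)"
      by (intro summable_mult2 summable_geometric) simp
    show "norm ((1/2) ^ j *\<^sub>R c j) \<le> (1/2) ^ j * B" for j
      using B[of j] by (simp add: mult_left_mono)
  qed
  then have lim_y: "(\<lambda>n. \<Sum>j<n. (1/2) ^ j *\<^sub>R c j) \<longlonglongrightarrow> y"
    unfolding y_def by (rule summable_LIMSEQ)
  have term_nonneg: "0 \<le> (1/2) ^ j *\<^sub>R c j" for j
    using c by (simp add: scaleR_nonneg_nonneg)
  have y_ge: "(1/2) ^ j *\<^sub>R c j \<le> y" for j
  proof (rule tendsto_ge_banach_lattice)
    show "(\<lambda>n. \<Sum>i<n + Suc j. (1/2) ^ i *\<^sub>R c i) \<longlonglongrightarrow> y"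
      using lim_y by (rule LIMSEQ_ignore_initial_segment)
    show "(1/2) ^ j *\<^sub>R c j \<le> (\<Sum>i<n + Suc j. (1/2) ^ i *\<^sub>R c i)" for n
      using term_nonneg sum_mono2[of "{..<n + Suc j}" "{j}" "\<lambda>i. (1/2) ^ i *\<^sub>R c i"] by simp
  qed
  have y_nonneg: "0 \<le> y"
    using term_nonneg y_ge by (rule order_trans)
  define v where "v k = pprt (c (Suc k) - 4 ^ k *\<^sub>R S k - (1/2) ^ k *\<^sub>R y)" for k
  have S_ge: "c j \<le> S k" if "j \<le> k" for j k
    unfolding S_def using that c sum_mono2[of "{..k}" "{j}" c] by simp
  have S_nonneg: "0 \<le> S k" for k
    unfolding S_def using c by (intro sum_nonneg)
  have sub_nonneg: "0 \<le> 4 ^ k *\<^sub>R S k" "0 \<le> (1/2) ^ k *\<^sub>R y" for k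
    using S_nonneg y_nonneg by (simp_all add: scaleR_nonneg_nonneg)
  have "disjoint_sequence v"
  proof (rule disjoint_sequenceI_nonneg)
    show "0 \<le> v k" for k by (simp add: v_def)
    fix k l :: nat assume "k < l"
    define z where "z = 4 ^ l *\<^sub>R c (Suc k) - c (Suc l)"
    have "v k \<le> pprt z"
    proof -
      \<comment> \<open>The term of index \<open>Suc l\<close> in \<open>y\<close> has weight \<open>(1/2) ^ Suc l\<close>, and \<open>k + Suc l \<le> 2 * l\<close>.\<close>
      have "(1/4) ^ l *\<^sub>R c (Suc l) \<le> ((1/2) ^ k * (1/2) ^ Suc l) *\<^sub>R c (Suc l)"
      proof (rule scaleR_right_mono[OF _ c])
        have "(1/4 :: real) ^ l = (1/2) ^ (2 * l)"
          by (simp add: power_mult power2_eq_square)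
        also have "\<dots> \<le> (1/2) ^ (k + Suc l)"
          using \<open>k < l\<close> by (intro power_decreasing) simp_all
        finally show "(1/4 :: real) ^ l \<le> (1/2) ^ k * (1/2) ^ Suc l"
          by (simp only: power_add)
      qed
      also have "\<dots> = (1/2) ^ k *\<^sub>R (1/2) ^ Suc l *\<^sub>R c (Suc l)"
        by simp
      also have "\<dots> \<le> (1/2) ^ k *\<^sub>R y"
        by (intro scaleR_left_mono y_ge) simp
      finally have "(1/4) ^ l *\<^sub>R c (Suc l) \<le> (1/2) ^ k *\<^sub>R y" .
      then have "c (Suc k) - 4 ^ k *\<^sub>R S k - (1/2) ^ k *\<^sub>R y \<le> c (Suc k) - 0 - (1/4) ^ l *\<^sub>R c (Suc l)"
        by (intro diff_mono sub_nonneg order_refl)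
      also have "\<dots> = (1/4) ^ l *\<^sub>R z"
        by (simp add: z_def scaleR_diff_right flip: power_mult_distrib)
      finally have "v k \<le> pprt ((1/4) ^ l *\<^sub>R z)"
        unfolding v_def by (rule pprt_mono)
      also have "\<dots> \<le> (1/4) ^ l *\<^sub>R pprt z"
        by (rule pprt_scaleR_le) simp
      also have "\<dots> \<le> 1 *\<^sub>R pprt z"
        by (intro scaleR_right_mono power_le_one) simp_all
      finally show ?thesis by simp
    qed
    moreover have "v l \<le> pprt (- z)"
    proof -
      have "4 ^ l *\<^sub>R c (Suc k) \<le> 4 ^ l *\<^sub>R S l"
        using \<open>k < l\<close> by (intro scaleR_left_mono S_ge) simp_all
      then have "c (Suc l) - 4 ^ l *\<^sub>R S l - (1/2) ^ l *\<^sub>R y \<le> c (Suc l) - 4 ^ l *\<^sub>R c (Suc k) - 0"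
        by (intro diff_mono sub_nonneg order_refl)
      then show ?thesis
        unfolding v_def z_def by (intro pprt_mono) simp
    qed
    ultimately have "inf (v k) (v l) \<le> inf (pprt z) (pprt (- z))"
      by (rule inf_mono)
    then show "inf (v k) (v l) \<le> 0"
      by (simp only: inf_pprt_pprt_uminus)
  qed
  then have v_null: "(\<lambda>k. norm (v k)) \<longlonglongrightarrow> 0"
  proof (rule L_weakly_compactD[OF L])
    fix k
    have "c (Suc k) - 4 ^ k *\<^sub>R S k - (1/2) ^ k *\<^sub>R y \<le> c (Suc k) - 0 - 0"
      by (intro diff_mono sub_nonneg order_refl)
    then have "v k \<le> c (Suc k)"
      unfolding v_def using c by (simp add: pprt_le_iff)
    then have "\<bar>v k\<bar> \<le> \<bar>c (Suc k)\<bar>"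
      using c by (simp add: v_def)
    then show "v k \<in> solid_hull (range c)"
      unfolding solid_hull_def by blast
  qed
  have bound: "norm (pprt (c (Suc k) - 4 ^ k *\<^sub>R S k)) \<le> norm (v k) + (1/2) ^ k * norm y" for k
  proof -
    have "pprt (c (Suc k) - 4 ^ k *\<^sub>R S k) \<le> v k + (1/2) ^ k *\<^sub>R y"
      using pprt_add_le[of "c (Suc k) - 4 ^ k *\<^sub>R S k - (1/2) ^ k *\<^sub>R y" "(1/2) ^ k *\<^sub>R y"]
      by (simp add: v_def sub_nonneg)
    then have "norm (pprt (c (Suc k) - 4 ^ k *\<^sub>R S k)) \<le> norm (v k + (1/2) ^ k *\<^sub>R y)"
      by (intro norm_mono_nonneg) simp_all
    also have "\<dots> \<le> norm (v k) + norm ((1/2) ^ k *\<^sub>R y)"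
      by (rule norm_triangle_ineq)
    finally show ?thesis by simp
  qed
  have "(\<lambda>k. norm (v k) + (1/2) ^ k * norm y) \<longlonglongrightarrow> 0 + 0 * norm y"
    by (intro tendsto_intros v_null LIMSEQ_power_zero) simp
  then have lim: "(\<lambda>k. norm (v k) + (1/2) ^ k * norm y) \<longlonglongrightarrow> 0" by simp
  show ?thesis
    by (rule Lim_null_comparison[OF always_eventually lim]) (use bound in \<open>simp add: S_def\<close>)
qed

text \<open>
  If every multiple \<open>U N = 4 ^ N (a 0 + \<dots> + a N)\<close> leaves some residual of norm above \<open>\<epsilon>\<close>, then
  iterating the choice of such a residual gives a subsequence that contradicts the previous lemma.
\<close>

lemma L_weakly_compact_almost_order_bounded:
  fixes a :: "nat \<Rightarrow> 'a::banach_lattice"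
  assumes L: "L_weakly_compact (range a)" and a: "\<And>n. 0 \<le> a n" and \<epsilon>: "0 < \<epsilon>"
  shows "\<exists>u. L_weakly_compact {0..u} \<and> (\<forall>n. norm (pprt (a n - u)) \<le> \<epsilon>)"
proof -
  define U where "U N = 4 ^ N *\<^sub>R (\<Sum>i\<le>N. a i)" for N
  have "\<exists>N. \<forall>n. norm (pprt (a n - U N)) \<le> \<epsilon>"
  proof (rule ccontr)
    assume "\<not> ?thesis"
    then obtain \<sigma> where \<sigma>: "\<And>N. \<epsilon> < norm (pprt (a (\<sigma> N) - U N))"
      by (metis not_le)
    \<comment> \<open>A term that occurs in the sum \<open>U N\<close> has no residual over \<open>U N\<close>.\<close>
    have "N < \<sigma> N" for N
    proof (rule ccontr)
      assume "\<not> N < \<sigma> N"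
      then have "a (\<sigma> N) \<le> (\<Sum>i\<le>N. a i)"
        using a sum_mono2[of "{..N}" "{\<sigma> N}" a] by simp
      also have "\<dots> = 1 *\<^sub>R (\<Sum>i\<le>N. a i)" by simp
      also have "\<dots> \<le> U N"
        unfolding U_def by (intro scaleR_right_mono sum_nonneg a) simp
      finally have "pprt (a (\<sigma> N) - U N) = 0" by simp
      with \<sigma>[of N] \<epsilon> show False by simp
    qed
    define r where "r k = (\<sigma> ^^ k) 0" for k
    have r: "strict_mono r"
      unfolding strict_mono_Suc_iff r_def using \<open>\<And>N. N < \<sigma> N\<close> by simp
    have large: "\<epsilon> \<le> norm (pprt (a (r (Suc k)) - 4 ^ k *\<^sub>R (\<Sum>j\<le>k. a (r j))))" for k
    proof -
      have "(\<Sum>j\<le>k. a (r j)) = (\<Sum>i\<in>r ` {..k}. a i)"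
        using strict_mono_imp_inj_on[OF r] by (simp add: sum.reindex inj_on_subset[of r UNIV])
      also have "\<dots> \<le> (\<Sum>i\<le>r k. a i)"
        using r a by (intro sum_mono2) (auto simp: strict_mono_less_eq)
      finally have "4 ^ k *\<^sub>R (\<Sum>j\<le>k. a (r j)) \<le> U (r k)"
        unfolding U_def using strict_mono_imp_increasing[OF r, of k] a
        by (intro scaleR_mono) (simp_all add: sum_nonneg)
      then have "pprt (a (r (Suc k)) - U (r k)) \<le> pprt (a (r (Suc k)) - 4 ^ k *\<^sub>R (\<Sum>j\<le>k. a (r j)))"
        by (intro pprt_mono diff_mono order_refl)
      then have "norm (pprt (a (r (Suc k)) - U (r k))) \<le> norm (pprt (a (r (Suc k)) - 4 ^ k *\<^sub>R (\<Sum>j\<le>k. a (r j))))"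
        by (intro norm_mono_nonneg zero_le_pprt)
      with \<sigma>[of "r k"] show ?thesis by (simp add: r_def)
    qed
    have "L_weakly_compact (range (\<lambda>k. a (r k)))"
    proof (rule L_weakly_compact_mono[OF L])
      show "range (\<lambda>k. a (r k)) \<subseteq> solid_hull (range a)"
        unfolding solid_hull_def by blast
    qed simp
    then have "(\<lambda>k. norm (pprt (a (r (Suc k)) - 4 ^ k *\<^sub>R (\<Sum>j\<le>k. a (r j))))) \<longlonglongrightarrow> 0"
      using a by (rule disjoint_residuals_null)
    then have "\<epsilon> \<le> 0"
      by (rule LIMSEQ_le_const) (use large in blast)
    with \<epsilon> show False by simp
  qed
  then obtain N where N: "\<And>n. norm (pprt (a n - U N)) \<le> \<epsilon>" by blast
  have "L_weakly_compact {0..real (4 ^ N) *\<^sub>R (\<Sum>i\<le>N. a i)}"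
    using L a
    by (intro L_weakly_compact_interval_scaleR_of_nat L_weakly_compact_interval_sum
        L_weakly_compact_interval_element[of "range a"]) simp_all
  then have "L_weakly_compact {0..U N}"
    by (simp add: U_def)
  with N show ?thesis by blast
qed

section \<open>Positive weakly null sequences and Dunford-Pettis operators\<close>

text \<open>
  Each \<open>a n\<close> is the sum of \<open>pprt (a n - u)\<close>, which is uniformly small for a suitable \<open>u\<close>, and of
  \<open>inf (a n) u\<close>, an order bounded sequence on which positive functionals tend to zero.
\<close>

theorem positive_weakly_null_norm_null:
  fixes a :: "nat \<Rightarrow> 'a::banach_lattice"
  assumes L: "L_weakly_compact (range a)" and a: "\<And>n. 0 \<le> a n" and null: "weakly_null a"
  shows "(\<lambda>n. norm (a n)) \<longlonglongrightarrow> 0"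
proof (rule LIMSEQ_I)
  fix \<epsilon> :: real assume "0 < \<epsilon>"
  then obtain u where u: "L_weakly_compact {0..u}" and small: "\<And>n. norm (pprt (a n - u)) \<le> \<epsilon> / 2"
    using L_weakly_compact_almost_order_bounded[OF L a, of "\<epsilon> / 2"] by auto
  have "0 \<le> u" using u by (simp add: L_weakly_compact_def)
  have "(\<lambda>n. norm (inf (a n) u)) \<longlonglongrightarrow> 0"
  proof (rule order_bounded_weakly_null_norm_null[OF u])
    show nonneg: "0 \<le> inf (a n) u" for n using a \<open>0 \<le> u\<close> by simp
    show "inf (a n) u \<le> u" for n by simp
    fix g :: "'a \<Rightarrow> real" assume g: "bounded_linear g" "\<And>x. 0 \<le> x \<Longrightarrow> 0 \<le> g x"
    have lim: "(\<lambda>n. g (a n)) \<longlonglongrightarrow> 0"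
      using null g(1) unfolding weakly_null_iff by simp
    show "(\<lambda>n. g (inf (a n) u)) \<longlonglongrightarrow> 0"
    proof (rule Lim_null_comparison[OF always_eventually lim], rule allI)
      fix n
      show "norm (g (inf (a n) u)) \<le> g (a n)"
        using g(2)[OF nonneg] positive_functional_mono[OF g inf_le1] by simp
    qed
  qed
  then have "\<forall>\<^sub>F n in sequentially. norm (inf (a n) u) < \<epsilon> / 2"
    by (rule order_tendstoD(2)) (simp add: \<open>0 < \<epsilon>\<close>)
  then obtain n0 where n0: "\<And>n. n \<ge> n0 \<Longrightarrow> norm (inf (a n) u) < \<epsilon> / 2"
    unfolding eventually_sequentially by blast
  have "norm (a n) < \<epsilon>" if "n \<ge> n0" for n
    using norm_triangle_ineq[of "pprt (a n - u)" "inf (a n) u"] small[of n] n0[OF that]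
    by (simp add: pprt_diff_add_inf)
  then show "\<exists>n0. \<forall>n\<ge>n0. norm (norm (a n) - 0) < \<epsilon>" by auto
qed

theorem proposition2p7:
  fixes T :: "'x::banach \<Rightarrow> 'e::banach_lattice"
  assumes "weakly_seq_continuous_lattice_operations TYPE('e)"
    and "bounded_linear T"
    and "almost_L_weakly_compact T"
  shows "Dunford_Pettis T"
  unfolding Dunford_Pettis_def
proof (intro allI impI)
  fix x :: "nat \<Rightarrow> 'x" assume x: "weakly_null x"
  define A where "A = insert 0 (range x)"
  have "weakly_null (\<lambda>n. T (x n))"
    unfolding weakly_null_iff
  proof (intro allI impI)
    fix f :: "'e \<Rightarrow> real" assume "bounded_linear f"
    then have "bounded_linear (\<lambda>z. f (T z))"
      using assms(2) by (rule bounded_linear_compose)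
    then show "(\<lambda>n. f (T (x n))) \<longlonglongrightarrow> 0"
      using x unfolding weakly_null_iff by blast
  qed
  then have null: "weakly_null (\<lambda>n. \<bar>T (x n)\<bar>)"
    using assms(1) by (simp add: weakly_seq_continuous_lattice_operations_def)
  have "A \<noteq> {}" "relatively_weakly_compact A"
    unfolding A_def using relatively_weakly_compact_weakly_null[OF x] by simp_all
  then have "L_weakly_compact (T ` A)"
    using assms(3) unfolding almost_L_weakly_compact_def by blast
  then have "L_weakly_compact (range (\<lambda>n. \<bar>T (x n)\<bar>))"
  proof (rule L_weakly_compact_mono)
    show "range (\<lambda>n. \<bar>T (x n)\<bar>) \<subseteq> solid_hull (T ` A)"
      unfolding solid_hull_def A_def by auto
  qed simp
  then have "(\<lambda>n. norm \<bar>T (x n)\<bar>) \<longlonglongrightarrow> 0"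
    by (rule positive_weakly_null_norm_null[OF _ abs_ge_zero null])
  then show "(\<lambda>n. norm (T (x n))) \<longlonglongrightarrow> 0"
    by (simp add: norm_abs)
qed

end
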